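(* Let $(R,f)$ be a Reeb poset and let $\pi:R\to T_f(R)$ be the projection map to its Reeb tree poset. Then for all $x,x'\in R$, $$|d_f(x,x')-t_f(\pi(x),\pi(x'))|\le 2\,\log\big(2\,M_F(R)\big)\,\mathrm{hyp}^{\leq}_f(R),$$ where the logarithm is to base $2$.
   Context: All posets are finite and connected (any two points are joined by a finite sequence whose consecutive elements are comparable). A Reeb poset $(R,f)$ is a poset $R$ with a strictly order preserving map $f:R\to\mathbb R$ ($x<y\Rightarrow f(x)<f(y)$). A poset path from $x$ to $y$ is a tuple $(x_0,\dots,x_n)$ with $x_0=x$, $x_n=y$ and $x_{i-1}$ comparable to $x_i$ for $i=1,\dots,n$; $\Gamma^{\leq}(x,y)$ is the set of these. The Reeb metric of $(R,f)$ is $d_f(x,y):=\min\{\sum_{i=1}^n|f(x_i)-f(x_{i-1})|:(x_0,\dots,x_n)\in\Gamma^{\leq}(x,y)\}$. Reeb tree poset: on $R$ put $x\sim y$ if there is a path in $\Gamma^{\leq}(x,y)$ all of whose points $x_i$ satisfy $f(x_i)\ge\max(f(x),f(y))$. This is an equivalence relation; $T_f(R)$ is the quotient set, and $\pi(x)=\tilde x$ is the class of $x$. $T_f(R)$ is partially ordered by: $\tilde x\le\tilde y$ if there is a path in $\Gamma^{\leq}(x,y)$ with $f(x_i)\ge f(x)$ for all its points $x_i$. The map $f$ descends to a strictly order preserving map on $T_f(R)$, and $t_f$ denotes the Reeb metric of $(T_f(R),f)$. Poset hyperbolicity: $\mathrm{g}^{\leq}_f(x,y):=\frac12(f(x)+f(y)-d_f(x,y))$,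 and $\mathrm{hyp}^{\leq}_f(R)$ is the minimal $\epsilon\ge0$ such that $\mathrm{g}^{\leq}_f(x,z)\ge\min(\mathrm{g}^{\leq}_f(x,y),\mathrm{g}^{\leq}_f(y,z))-\epsilon$ for all $x,y,z\in R$. A fence in $R$ is a subset $F$ whose elements can be numbered (without repetition) $x_0,\dots,x_n$ so that $x_{i-1}$ and $x_i$ are comparable for $i=1,\dots,n$ and no other two distinct elements are comparable; its length is $n=|F|-1$. $M_F(R):=\max\{|F|-1 : F \text{ a fence in } R\}$ is the maximal length of a fence in $R$. *)

theory Defs
  imports Complex_Main
begin

text \<open>
  Posets are given by a carrier \<open>A\<close> and an order relation \<open>r \<subseteq> A \<times> A\<close>, so that
  a poset and its quotient are covered by the same definitions.
\<close>

definition comparable :: "('a \<times> 'a) set \<Rightarrow> 'a \<Rightarrow> 'a \<Rightarrow> bool" where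
  "comparable r x y \<longleftrightarrow> (x, y) \<in> r \<or> (y, x) \<in> r"

definition poset_paths :: "'a set \<Rightarrow> ('a \<times> 'a) set \<Rightarrow> 'a \<Rightarrow> 'a \<Rightarrow> 'a list set" where
  "poset_paths A r x y =
     {p. p \<noteq> [] \<and> set p \<subseteq> A \<and> hd p = x \<and> last p = y \<and> successively (comparable r) p}"

definition reeb_poset :: "'a set \<Rightarrow> ('a \<times> 'a) set \<Rightarrow> ('a \<Rightarrow> real) \<Rightarrow> bool" where
  "reeb_poset A r f \<longleftrightarrow>
     finite A \<and> partial_order_on A r \<and>
     (\<forall>x\<in>A. \<forall>y\<in>A. poset_paths A r x y \<noteq> {}) \<and>
     (\<forall>x y. (x, y) \<in> r \<and> x \<noteq> y \<longrightarrow> f x < f y)"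

definition path_length :: "('a \<Rightarrow> real) \<Rightarrow> 'a list \<Rightarrow> real" where
  "path_length f p = (\<Sum>i = 1..<length p. \<bar>f (p ! i) - f (p ! (i - 1))\<bar>)"

text \<open>
  For a Reeb poset the infimum is a minimum: cutting out the part of a path between two
  visits to the same point does not increase its length, and a finite poset has only
  finitely many paths without repetition.
\<close>

definition reeb_dist :: "'a set \<Rightarrow> ('a \<times> 'a) set \<Rightarrow> ('a \<Rightarrow> real) \<Rightarrow> 'a \<Rightarrow> 'a \<Rightarrow> real" where
  "reeb_dist A r f x y = Inf (path_length f ` poset_paths A r x y)"

definition tree_equiv :: "'a set \<Rightarrow> ('a \<times> 'a) set \<Rightarrow> ('a \<Rightarrow> real) \<Rightarrow> ('a \<times> 'a) set" where
  "tree_equiv A r f =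
     {(x, y). x \<in> A \<and> y \<in> A \<and>
        (\<exists>p\<in>poset_paths A r x y. \<forall>z\<in>set p. f z \<ge> max (f x) (f y))}"

definition tree_proj :: "'a set \<Rightarrow> ('a \<times> 'a) set \<Rightarrow> ('a \<Rightarrow> real) \<Rightarrow> 'a \<Rightarrow> 'a set" where
  "tree_proj A r f x = tree_equiv A r f `` {x}"

definition tree_carrier :: "'a set \<Rightarrow> ('a \<times> 'a) set \<Rightarrow> ('a \<Rightarrow> real) \<Rightarrow> 'a set set" where
  "tree_carrier A r f = A // tree_equiv A r f"

definition tree_order :: "'a set \<Rightarrow> ('a \<times> 'a) set \<Rightarrow> ('a \<Rightarrow> real) \<Rightarrow> ('a set \<times> 'a set) set" where
  "tree_order A r f =
     {(tree_proj A r f x, tree_proj A r f y) | x y. x \<in> A \<and> y \<in> A \<and>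
        (\<exists>p\<in>poset_paths A r x y. \<forall>z\<in>set p. f z \<ge> f x)}"

text \<open>
  The map induced on the quotient: \<open>f\<close> is constant on each class, since a path
  witnessing \<open>(x, y) \<in> tree_equiv A r f\<close> contains both \<open>x\<close> and \<open>y\<close>.
\<close>

definition tree_map :: "('a \<Rightarrow> real) \<Rightarrow> 'a set \<Rightarrow> real" where
  "tree_map f C = the_elem (f ` C)"

definition tree_dist :: "'a set \<Rightarrow> ('a \<times> 'a) set \<Rightarrow> ('a \<Rightarrow> real) \<Rightarrow> 'a set \<Rightarrow> 'a set \<Rightarrow> real" where
  "tree_dist A r f = reeb_dist (tree_carrier A r f) (tree_order A r f) (tree_map f)"

definition poset_gromov :: "'a set \<Rightarrow> ('a \<times> 'a) set \<Rightarrow> ('a \<Rightarrow> real) \<Rightarrow> 'a \<Rightarrow> 'a \<Rightarrow> real" where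
  "poset_gromov A r f x y = (f x + f y - reeb_dist A r f x y) / 2"

text \<open>
  For a finite carrier only finitely many inequalities constrain \<open>\<epsilon>\<close>, so the infimum is
  attained.
\<close>

definition poset_hyp :: "'a set \<Rightarrow> ('a \<times> 'a) set \<Rightarrow> ('a \<Rightarrow> real) \<Rightarrow> real" where
  "poset_hyp A r f =
     Inf {\<epsilon>. \<epsilon> \<ge> 0 \<and>
            (\<forall>x\<in>A. \<forall>y\<in>A. \<forall>z\<in>A.
               poset_gromov A r f x z
                 \<ge> min (poset_gromov A r f x y) (poset_gromov A r f y z) - \<epsilon>)}"

definition fence :: "'a set \<Rightarrow> ('a \<times> 'a) set \<Rightarrow> 'a set \<Rightarrow> bool" where
  "fence A r F \<longleftrightarrow>
     F \<subseteq> A \<and>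
     (\<exists>xs. xs \<noteq> [] \<and> distinct xs \<and> set xs = F \<and>
        (\<forall>i j. i < j \<and> j < length xs \<longrightarrow> (comparable r (xs ! i) (xs ! j) \<longleftrightarrow> j = Suc i)))"

definition max_fence_length :: "'a set \<Rightarrow> ('a \<times> 'a) set \<Rightarrow> nat" where
  "max_fence_length A r = Max {card F - 1 | F. fence A r F}"

end

theory Submission
  imports Defs
begin

text \<open>
  Write \<open>g\<close> for the Gromov product and \<open>h\<close> for the hyperbolicity. Projecting a path of \<open>R\<close> to
  the tree keeps its length, so \<open>t \<le> d\<close>. For the other direction, take any path \<open>P\<close> in the tree
  from \<open>\<pi> x\<close> to \<open>\<pi> x'\<close> and let \<open>c\<close> be the lowest value on it. Since \<open>P\<close> has to descend
  to height \<open>c\<close> and climb back, its length is at least \<open>f x + f x' - 2 c\<close>. On the other hand,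
  comparability in the tree means being joined in \<open>R\<close> above the lower of the two heights, so
  \<open>P\<close> lifts to a path of \<open>R\<close> from \<open>x\<close> to \<open>x'\<close> inside the superlevel set \<open>{f \<ge> c}\<close>.

  A shortest path in this superlevel set has no shortcuts, hence is a fence and has at most
  \<open>M = M_F(R)\<close> steps. Each step joins comparable points, whose Gromov product is the smaller of
  their values and therefore at least \<open>c\<close>. Bisecting the fence \<open>\<lceil>log 2 M\<rceil> \<le> log 2 (2 M)\<close> times,
  at a cost of \<open>h\<close> each time, gives \<open>g x x' \<ge> c - log 2 (2 M) h\<close>, that is,
  \<open>d x x' \<le> f x + f x' - 2 c + 2 log 2 (2 M) h\<close>. The right-hand side is at most the length of \<open>P\<close>
  plus the claimed bound; taking the infimum over \<open>P\<close> finishes the proof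
  (\<open>tree_dist_le_reeb_dist\<close> and \<open>reeb_dist_le_tree_dist\<close>).
\<close>

section \<open>Paths and their length\<close>

lemma path_length_singleton [simp]: "path_length f [x] = 0"
  by (simp add: path_length_def)

lemma path_length_Cons_Cons [simp]:
  "path_length f (x # y # p) = \<bar>f y - f x\<bar> + path_length f (y # p)"
proof -
  have "(\<Sum>i = 1..<Suc (Suc (length p)). \<bar>f ((x # y # p) ! i) - f ((x # y # p) ! (i - 1))\<bar>)
      = \<bar>f y - f x\<bar> + (\<Sum>i = Suc 1..<Suc (Suc (length p)).
            \<bar>f ((x # y # p) ! i) - f ((x # y # p) ! (i - 1))\<bar>)"
    by (subst sum.atLeast_Suc_lessThan) simp_all
  also have "(\<Sum>i = Suc 1..<Suc (Suc (length p)).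
            \<bar>f ((x # y # p) ! i) - f ((x # y # p) ! (i - 1))\<bar>)
      = (\<Sum>i = 1..<Suc (length p). \<bar>f ((y # p) ! i) - f ((y # p) ! (i - 1))\<bar>)"
    unfolding sum.shift_bounds_Suc_ivl
    by (rule sum.cong) (auto simp: nth_Cons split: nat.split)
  finally show ?thesis
    by (simp add: path_length_def)
qed

lemma path_length_nonneg: "0 \<le> path_length f p"
  by (simp add: path_length_def sum_nonneg)

lemma path_length_map:
  assumes "\<And>x. x \<in> set p \<Longrightarrow> g (h x) = f x"
  shows "path_length g (map h p) = path_length f p"
  using assms unfolding path_length_def by (auto intro!: sum.cong)

text \<open>A path through \<open>z\<close> has to cover the height difference to \<open>z\<close> from both of its ends.\<close>

lemma path_length_ge_via:
  assumes "p \<noteq> []" and "z \<in> set p"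
  shows "\<bar>f (hd p) - f z\<bar> + \<bar>f z - f (last p)\<bar> \<le> path_length f p"
  using assms
proof (induction p arbitrary: z rule: induct_list012)
  case (3 x y p)
  show ?case
  proof (cases "z = x")
    case True
    then show ?thesis using "3.IH"(2)[of y] by auto
  next
    case False
    then show ?thesis using "3.IH"(2)[of z] "3.prems" by auto
  qed
qed auto

lemma poset_pathsI:
  "p \<noteq> [] \<Longrightarrow> set p \<subseteq> A \<Longrightarrow> hd p = x \<Longrightarrow> last p = y \<Longrightarrow> successively (comparable r) p
    \<Longrightarrow> p \<in> poset_paths A r x y"
  by (simp add: poset_paths_def)

lemma poset_pathsD:
  assumes "p \<in> poset_paths A r x y"
  shows "p \<noteq> []" "set p \<subseteq> A" "hd p = x" "last p = y" "successively (comparable r) p"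
    "x \<in> set p" "y \<in> set p"
  using assms by (auto simp: poset_paths_def)

lemma comparable_sym: "comparable r x y \<longleftrightarrow> comparable r y x"
  by (auto simp: comparable_def)

lemma poset_paths_rev:
  assumes "p \<in> poset_paths A r x y"
  shows "rev p \<in> poset_paths A r y x"
proof -
  note pD = poset_pathsD[OF assms]
  have "successively (\<lambda>u v. comparable r v u) p"
    by (rule successively_mono[OF pD(5)]) (simp add: comparable_sym)
  then show ?thesis
    using pD by (intro poset_pathsI) (simp_all add: hd_rev last_rev)
qed

lemma poset_paths_join:
  assumes "p \<in> poset_paths A r x y" and "q \<in> poset_paths A r y z"
  shows "p @ tl q \<in> poset_paths A r x z"
proof -
  obtain q' where q: "q = y # q'"
    using poset_pathsD(1,3)[OF assms(2)] by (cases q) auto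
  show ?thesis
    using assms unfolding q poset_paths_def
    by (auto simp: successively_append_iff successively_Cons)
qed

lemma joined_trans:
  assumes "poset_paths A r x y \<noteq> {}" and "poset_paths A r y z \<noteq> {}"
  shows "poset_paths A r x z \<noteq> {}"
proof -
  obtain p q where "p \<in> poset_paths A r x y" "q \<in> poset_paths A r y z"
    using assms by auto
  from poset_paths_join[OF this] show ?thesis by auto
qed

section \<open>The Reeb distance and the Gromov product\<close>

lemma reeb_dist_le_path_length:
  assumes "p \<in> poset_paths A r x y"
  shows "reeb_dist A r f x y \<le> path_length f p"
  unfolding reeb_dist_def
  using assms by (auto intro!: cInf_lower bdd_belowI[of _ 0] simp: path_length_nonneg)

lemma reeb_dist_greatest:
  assumes "poset_paths A r x y \<noteq> {}"
    and "\<And>p. p \<in> poset_paths A r x y \<Longrightarrow> b \<le> path_length f p"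
  shows "b \<le> reeb_dist A r f x y"
  unfolding reeb_dist_def using assms by (auto intro!: cInf_greatest)

lemma poset_gromov_comparable_ge:
  assumes "x \<in> A" "y \<in> A" "comparable r x y"
  shows "min (f x) (f y) \<le> poset_gromov A r f x y"
proof -
  have "[x, y] \<in> poset_paths A r x y"
    using assms by (simp add: poset_paths_def)
  from reeb_dist_le_path_length[OF this, of f] show ?thesis
    by (simp add: poset_gromov_def min_def abs_if split: if_splits)
qed

text \<open>
  The infimum defining the hyperbolicity itself satisfies the hyperbolic inequality because each
  triple contributes a lower bound for the admissible \<open>\<epsilon>\<close>. Finiteness provides an admissible
  \<open>\<epsilon>\<close>, the largest defect, without which the infimum would be meaningless.
\<close>

lemma
  assumes "finite A"
  shows poset_hyp_nonneg: "0 \<le> poset_hyp A r f"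
    and poset_gromov_hyperbolic:
      "x \<in> A \<Longrightarrow> y \<in> A \<Longrightarrow> z \<in> A \<Longrightarrow>
        min (poset_gromov A r f x y) (poset_gromov A r f y z) - poset_hyp A r f
          \<le> poset_gromov A r f x z"
proof -
  define g where "g = poset_gromov A r f"
  define defect where
    "defect = (\<lambda>(x, y, z). min (g x y) (g y z) - g x z)"
  define E where
    "E = {\<epsilon>. 0 \<le> \<epsilon> \<and> (\<forall>x\<in>A. \<forall>y\<in>A. \<forall>z\<in>A. g x z \<ge> min (g x y) (g y z) - \<epsilon>)}"
  have hyp: "poset_hyp A r f = Inf E"
    by (simp add: poset_hyp_def E_def g_def)
  have "Max (insert 0 (defect ` (A \<times> A \<times> A))) \<in> E"
  proof -
    have fin: "finite (insert 0 (defect ` (A \<times> A \<times> A)))"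
      using assms by simp
    have "defect (x, y, z) \<le> Max (insert 0 (defect ` (A \<times> A \<times> A)))"
      if "x \<in> A" "y \<in> A" "z \<in> A" for x y z
      using that by (intro Max_ge[OF fin]) blast
    moreover have "0 \<le> Max (insert 0 (defect ` (A \<times> A \<times> A)))"
      by (intro Max_ge[OF fin]) simp
    ultimately show ?thesis
      by (fastforce simp: E_def defect_def)
  qed
  then have ne: "E \<noteq> {}" by blast
  show "0 \<le> poset_hyp A r f"
    unfolding hyp by (rule cInf_greatest[OF ne]) (simp add: E_def)
  show "min (poset_gromov A r f x y) (poset_gromov A r f y z) - poset_hyp A r f
          \<le> poset_gromov A r f x z" if "x \<in> A" "y \<in> A" "z \<in> A"
  proof -
    have "min (g x y) (g y z) - g x z \<le> Inf E"
      using that by (intro cInf_greatest[OF ne]) (fastforce simp: E_def)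
    then show ?thesis
      by (simp add: hyp g_def)
  qed
qed

section \<open>Shortest paths are fences\<close>

text \<open>
  In a path of minimal length, two comparable points that are not neighbours would give a
  shortcut, and a repeated point would allow the loop between its visits to be cut out.
\<close>

lemma ex_induced_path:
  assumes "poset_paths A r x y \<noteq> {}"
  obtains p where "p \<in> poset_paths A r x y" "distinct p"
    "\<And>i j. i < j \<Longrightarrow> j < length p \<Longrightarrow> comparable r (p ! i) (p ! j) \<longleftrightarrow> j = Suc i"
proof -
  obtain p where p: "p \<in> poset_paths A r x y"
    and shortest: "\<And>q. q \<in> poset_paths A r x y \<Longrightarrow> length p \<le> length q"
    using ex_has_least_nat[of "\<lambda>p. p \<in> poset_paths A r x y" _ length] assms by blast
  note pD = poset_pathsD[OF p]
  have split: "\<exists>as bs cs. p = as @ p ! i # bs @ p ! j # cs \<and> length bs = j - Suc i"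
    if "i < j" "j < length p" for i j
  proof -
    have "drop (Suc i) p = take (j - Suc i) (drop (Suc i) p) @ p ! j # drop (Suc j) p"
      using that id_take_nth_drop[of "j - Suc i" "drop (Suc i) p"] by simp
    then have "p = take i p @ p ! i # take (j - Suc i) (drop (Suc i) p) @ p ! j # drop (Suc j) p"
      using that id_take_nth_drop[of i p] by simp
    then show ?thesis
      using that by (intro exI conjI) (assumption, simp)
  qed
  have "p ! i \<noteq> p ! j" if ij: "i < j" "j < length p" for i j
  proof
    assume eq: "p ! i = p ! j"
    obtain as bs cs where s: "p = as @ p ! i # bs @ p ! j # cs"
      using split[OF ij] by blast
    obtain v where v: "p = as @ v # bs @ v # cs"
      using s eq by metis
    have "as @ v # cs \<in> poset_paths A r x y"
      using p unfolding v poset_paths_def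
      by (auto simp: successively_append_iff successively_Cons hd_append split: if_splits)
    from shortest[OF this] show False
      by (simp add: v)
  qed
  then have dist: "distinct p"
    unfolding distinct_conv_nth by (metis linorder_neqE_nat)
  have induced: "comparable r (p ! i) (p ! j) \<longleftrightarrow> j = Suc i"
    if ij: "i < j" "j < length p" for i j
  proof
    assume "j = Suc i"
    then show "comparable r (p ! i) (p ! j)"
      using pD(5) ij by (auto simp: successively_conv_nth)
  next
    assume c: "comparable r (p ! i) (p ! j)"
    obtain as bs cs where s: "p = as @ p ! i # bs @ p ! j # cs" "length bs = j - Suc i"
      using split[OF ij] by blast
    obtain u v where v: "p = as @ u # bs @ v # cs" "comparable r u v"
      using s(1) c by metis
    have "as @ u # v # cs \<in> poset_paths A r x y"
      using p v(2) unfolding v(1) poset_paths_def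
      by (auto simp: successively_append_iff successively_Cons hd_append split: if_splits)
    from shortest[OF this] have "length bs = 0"
      by (simp add: v(1))
    then show "j = Suc i"
      using s(2) ij by simp
  qed
  show thesis
    using that[OF p dist induced] .
qed

lemma induced_path_length_le:
  assumes "finite A" "p \<noteq> []" "set p \<subseteq> A" "distinct p"
    and "\<And>i j. i < j \<Longrightarrow> j < length p \<Longrightarrow> comparable r (p ! i) (p ! j) \<longleftrightarrow> j = Suc i"
  shows "length p - 1 \<le> max_fence_length A r"
proof -
  have "{card F - 1 | F. fence A r F} \<subseteq> (\<lambda>F. card F - 1) ` Pow A"
    by (auto simp: fence_def)
  then have "finite {card F - 1 | F. fence A r F}"
    by (rule finite_subset) (simp add: assms(1))
  moreover have "fence A r (set p)"
    unfolding fence_def using assms by blast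
  ultimately show ?thesis
    unfolding max_fence_length_def
    using distinct_card[OF assms(4)] by (intro Max_ge) (auto intro!: exI[of _ "set p"])
qed

section \<open>Bisection in a hyperbolic space\<close>

text \<open>
  Halving a chain of at most \<open>2 ^ k\<close> steps costs one application of the hyperbolic inequality
  and leaves two chains of at most \<open>2 ^ (k - 1)\<close> steps. The case \<open>i = j\<close> is included so that the
  two halves need not be non-trivial.
\<close>

lemma hyperbolic_chain_dyadic:
  fixes g :: "'a \<Rightarrow> 'a \<Rightarrow> real" and s :: "nat \<Rightarrow> 'a"
  assumes hyp: "\<And>i j l. i \<le> n \<Longrightarrow> j \<le> n \<Longrightarrow> l \<le> n \<Longrightarrow>
      min (g (s i) (s j)) (g (s j) (s l)) - h \<le> g (s i) (s l)"
    and self: "\<And>i. i \<le> n \<Longrightarrow> c \<le> g (s i) (s i)"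
    and step: "\<And>i. i < n \<Longrightarrow> c \<le> g (s i) (s (Suc i))"
    and "i \<le> j" "j \<le> n" "j - i \<le> 2 ^ k"
  shows "c - real k * h \<le> g (s i) (s j)"
  using assms(4-)
proof (induction k arbitrary: i j)
  case 0
  then have "j = i \<or> j = Suc i" by auto
  then show ?case using self[of i] step[of i] 0 by auto
next
  case (Suc k)
  define m where "m = i + (j - i) div 2"
  have m: "i \<le> m" "m \<le> j" "m \<le> n" "m - i \<le> 2 ^ k" "j - m \<le> 2 ^ k"
    using Suc.prems by (auto simp: m_def)
  have "c - real k * h \<le> g (s i) (s m)" "c - real k * h \<le> g (s m) (s j)"
    using Suc.IH[of i m] Suc.IH[of m j] m Suc.prems by auto
  moreover have "min (g (s i) (s m)) (g (s m) (s j)) - h \<le> g (s i) (s j)"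
    using hyp[of i m j] m Suc.prems by auto
  ultimately show ?case
    by (simp add: algebra_simps min_def split: if_splits)
qed

text \<open>
  Padding the number of steps to the next power of two adds less than one halving, which is what
  the factor \<open>2\<close> inside the logarithm pays for.
\<close>

lemma hyperbolic_chain:
  fixes g :: "'a \<Rightarrow> 'a \<Rightarrow> real" and s :: "nat \<Rightarrow> 'a"
  assumes "0 < n" and "0 \<le> h"
    and "\<And>i j l. i \<le> n \<Longrightarrow> j \<le> n \<Longrightarrow> l \<le> n \<Longrightarrow>
      min (g (s i) (s j)) (g (s j) (s l)) - h \<le> g (s i) (s l)"
    and "\<And>i. i \<le> n \<Longrightarrow> c \<le> g (s i) (s i)"
    and "\<And>i. i < n \<Longrightarrow> c \<le> g (s i) (s (Suc i))"
  shows "c - log 2 (2 * real n) * h \<le> g (s 0) (s n)"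
proof -
  define k where "k = nat \<lceil>log 2 (real n)\<rceil>"
  have "0 \<le> log 2 (real n)"
    using assms(1) by simp
  then have k: "log 2 (real n) \<le> real k" "real k \<le> log 2 (real n) + 1"
    unfolding k_def by linarith+
  have "real n = 2 powr log 2 (real n)"
    using assms(1) by simp
  also have "\<dots> \<le> 2 powr real k"
    using k(1) by simp
  finally have "real n \<le> real (2 ^ k)"
    by (simp add: powr_realpow)
  then have "n \<le> 2 ^ k"
    by (simp only: of_nat_le_iff)
  then have "c - real k * h \<le> g (s 0) (s n)"
    using hyperbolic_chain_dyadic[where i = 0 and j = n and n = n and s = s and g = g] assms(3-)
    by simp
  moreover have "real k * h \<le> log 2 (2 * real n) * h"
    using k(2) assms(1,2) by (intro mult_right_mono) (simp_all add: log_mult)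
  ultimately show ?thesis by linarith
qed

text \<open>
  A one-point poset has no fence of positive length; there the convention \<open>log 2 0 = 0\<close> keeps the
  bound non-negative.
\<close>

lemma log_two_double_nat_nonneg: "0 \<le> log 2 (2 * real n)"
  by (cases "n = 0") (simp_all add: log_def)

text \<open>
  The lower bound on the Gromov product depends only on the height above which two points can
  be joined, not on the length of the joining path: the latter may be replaced by a fence.
\<close>

lemma poset_gromov_ge_if_joined_above:
  assumes R: "reeb_poset A r f"
    and joined: "poset_paths {z \<in> A. c \<le> f z} r x y \<noteq> {}"
  shows "c - log 2 (2 * real (max_fence_length A r)) * poset_hyp A r f \<le> poset_gromov A r f x y"
proof -
  have fin: "finite A" and refl: "\<And>z. z \<in> A \<Longrightarrow> (z, z) \<in> r"
    using R by (auto simp: reeb_poset_def partial_order_on_def preorder_on_def refl_on_def)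
  let ?M = "max_fence_length A r" and ?h = "poset_hyp A r f" and ?g = "poset_gromov A r f"
  note h = poset_hyp_nonneg[OF fin, of r f]
  obtain p where p: "p \<in> poset_paths {z \<in> A. c \<le> f z} r x y" "distinct p"
    and induced: "\<And>i j. i < j \<Longrightarrow> j < length p \<Longrightarrow> comparable r (p ! i) (p ! j) \<longleftrightarrow> j = Suc i"
    by (rule ex_induced_path[OF joined]) blast
  note pD = poset_pathsD[OF p(1)]
  define n where "n = length p - 1"
  have len: "length p = Suc n"
    using pD(1) by (cases p) (auto simp: n_def)
  have mem: "p ! i \<in> A" "c \<le> f (p ! i)" if "i \<le> n" for i
    using subsetD[OF pD(2) nth_mem[of i p]] that len by auto
  have ends: "p ! 0 = x" "p ! n = y"
    using pD(1,3,4) by (simp_all add: n_def hd_conv_nth last_conv_nth)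
  have comp_ge: "c \<le> ?g (p ! i) (p ! j)"
    if "i \<le> n" "j \<le> n" "comparable r (p ! i) (p ! j)" for i j
    using poset_gromov_comparable_ge[of "p ! i" A "p ! j" r f] mem[OF that(1)] mem[OF that(2)] that(3)
    by simp
  have self: "c \<le> ?g (p ! i) (p ! i)" if "i \<le> n" for i
    using that mem refl by (intro comp_ge) (auto simp: comparable_def)
  show ?thesis
  proof (cases "n = 0")
    case True
    then have "c \<le> ?g x y"
      using self[of 0] ends by simp
    moreover have "0 \<le> log 2 (2 * real ?M) * ?h"
      using h log_two_double_nat_nonneg by simp
    ultimately show ?thesis by linarith
  next
    case False
    have "c - log 2 (2 * real n) * ?h \<le> ?g (p ! 0) (p ! n)"
    proof (rule hyperbolic_chain[where g = ?g and s = "(!) p"])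
      show "c \<le> ?g (p ! i) (p ! Suc i)" if "i < n" for i
        using that induced[of i "Suc i"] len by (intro comp_ge) auto
    qed (use False h self mem poset_gromov_hyperbolic[OF fin] in auto)
    moreover have "n \<le> ?M"
      using induced_path_length_le[OF fin pD(1) _ p(2), of r] induced pD(2)
      unfolding n_def by blast
    then have "log 2 (2 * real n) * ?h \<le> log 2 (2 * real ?M) * ?h"
      using False h by (intro mult_right_mono) auto
    ultimately show ?thesis
      using ends by simp
  qed
qed

section \<open>The Reeb tree poset\<close>

lemma tree_equivD:
  assumes "(x, y) \<in> tree_equiv A r f"
  shows "x \<in> A" "y \<in> A" "f x = f y" "poset_paths {z \<in> A. f x \<le> f z} r x y \<noteq> {}"
proof -
  obtain p where p: "x \<in> A" "y \<in> A" "p \<in> poset_paths A r x y" "\<forall>z\<in>set p. max (f x) (f y) \<le> f z"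
    using assms by (auto simp: tree_equiv_def)
  then show "x \<in> A" "y \<in> A" by simp_all
  show "f x = f y"
    using bspec[OF p(4) poset_pathsD(6)[OF p(3)]] bspec[OF p(4) poset_pathsD(7)[OF p(3)]] by simp
  have "p \<in> poset_paths {z \<in> A. f x \<le> f z} r x y"
    using p(3,4) by (auto simp: poset_paths_def)
  then show "poset_paths {z \<in> A. f x \<le> f z} r x y \<noteq> {}" by blast
qed

lemma tree_equiv_refl:
  assumes "x \<in> A"
  shows "(x, x) \<in> tree_equiv A r f"
proof -
  have "[x] \<in> poset_paths A r x x"
    using assms by (intro poset_pathsI) simp_all
  moreover have "\<forall>z\<in>set [x]. max (f x) (f x) \<le> f z"
    by simp
  ultimately show ?thesis
    unfolding tree_equiv_def using assms by blast
qed

lemma tree_proj_eqD: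
  assumes "y \<in> A" "tree_proj A r f x = tree_proj A r f y"
  shows "(x, y) \<in> tree_equiv A r f"
proof -
  have "y \<in> tree_proj A r f y"
    using tree_equiv_refl[OF assms(1)] by (simp add: tree_proj_def)
  then have "y \<in> tree_proj A r f x"
    by (simp only: assms(2))
  then show ?thesis
    by (simp add: tree_proj_def)
qed

lemma tree_map_proj:
  assumes "x \<in> A"
  shows "tree_map f (tree_proj A r f x) = f x"
proof -
  have "x \<in> tree_proj A r f x"
    using tree_equiv_refl[OF assms] by (simp add: tree_proj_def)
  moreover have "f y = f x" if "y \<in> tree_proj A r f x" for y
    using that tree_equivD(3)[of x y A r f] by (simp add: tree_proj_def)
  ultimately have "f ` tree_proj A r f x = {f x}"
    by (metis (no_types, lifting) image_cong image_constant)
  then show ?thesis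
    by (simp add: tree_map_def)
qed

lemma tree_proj_comparable:
  assumes R: "reeb_poset A r f" and "x \<in> A" "y \<in> A" "comparable r x y"
  shows "comparable (tree_order A r f) (tree_proj A r f x) (tree_proj A r f y)"
proof -
  have "(tree_proj A r f u, tree_proj A r f v) \<in> tree_order A r f"
    if "u \<in> A" "v \<in> A" "(u, v) \<in> r" for u v
  proof -
    have "f u \<le> f v"
      using R that unfolding reeb_poset_def by (cases "u = v") (auto intro: less_imp_le)
    then have "[u, v] \<in> poset_paths A r u v \<and> (\<forall>z\<in>set [u, v]. f u \<le> f z)"
      using that by (auto simp: poset_paths_def comparable_def)
    then show ?thesis
      using that unfolding tree_order_def by blast
  qed
  then show ?thesis
    using assms unfolding comparable_def by blast
qed

lemma tree_proj_path:
  assumes "reeb_poset A r f" "p \<in> poset_paths A r x y"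
  shows "map (tree_proj A r f) p
    \<in> poset_paths (tree_carrier A r f) (tree_order A r f) (tree_proj A r f x) (tree_proj A r f y)"
proof -
  note pD = poset_pathsD[OF assms(2)]
  have "successively (comparable (tree_order A r f)) (map (tree_proj A r f) p)"
    unfolding successively_map
    by (rule successively_mono[OF pD(5)]) (use pD(2) tree_proj_comparable[OF assms(1)] in blast)
  moreover have "tree_proj A r f ` A \<subseteq> tree_carrier A r f"
    by (auto simp: tree_proj_def tree_carrier_def quotientI)
  ultimately show ?thesis
    using pD by (intro poset_pathsI) (auto simp: hd_map last_map)
qed

text \<open>The projection preserves comparability and \<open>f\<close>, hence the length of paths.\<close>

lemma tree_dist_le_reeb_dist:
  assumes R: "reeb_poset A r f" and "x \<in> A" "y \<in> A"
  shows "tree_dist A r f (tree_proj A r f x) (tree_proj A r f y) \<le> reeb_dist A r f x y"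
proof (rule reeb_dist_greatest)
  show "poset_paths A r x y \<noteq> {}"
    using assms by (simp add: reeb_poset_def)
next
  fix p assume p: "p \<in> poset_paths A r x y"
  have "path_length (tree_map f) (map (tree_proj A r f) p) = path_length f p"
    using poset_pathsD(2)[OF p] by (intro path_length_map tree_map_proj) blast
  then show "tree_dist A r f (tree_proj A r f x) (tree_proj A r f y) \<le> path_length f p"
    using reeb_dist_le_path_length[OF tree_proj_path[OF R p], of "tree_map f"]
    by (simp add: tree_dist_def)
qed

lemma joined_above_mono:
  assumes "poset_paths {z \<in> A. b \<le> f z} r x y \<noteq> {}" and "(c :: real) \<le> b"
  shows "poset_paths {z \<in> A. c \<le> f z} r x y \<noteq> {}"
proof -
  have "{z \<in> A. b \<le> f z} \<subseteq> {z \<in> A. c \<le> f z}"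
    using assms(2) by auto
  then have "poset_paths {z \<in> A. b \<le> f z} r x y \<subseteq> poset_paths {z \<in> A. c \<le> f z} r x y"
    unfolding poset_paths_def by blast
  then show ?thesis
    using assms(1) by auto
qed

lemma tree_comparableE:
  assumes "comparable (tree_order A r f) C D"
  obtains u v where "u \<in> A" "v \<in> A" "C = tree_proj A r f u" "D = tree_proj A r f v"
    "poset_paths {z \<in> A. min (f u) (f v) \<le> f z} r u v \<noteq> {}"
proof -
  have *: "\<exists>u v. u \<in> A \<and> v \<in> A \<and> C = tree_proj A r f u \<and> D = tree_proj A r f v \<and>
      (\<exists>p. p \<in> poset_paths {z \<in> A. min (f u) (f v) \<le> f z} r u v)"
    if CD: "(C, D) \<in> tree_order A r f" for C D
  proof -
    obtain u v p where "u \<in> A" "v \<in> A" "C = tree_proj A r f u" "D = tree_proj A r f v"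
      and p: "p \<in> poset_paths A r u v" "\<forall>z\<in>set p. f u \<le> f z"
      using CD unfolding tree_order_def by blast
    moreover have "p \<in> poset_paths {z \<in> A. min (f u) (f v) \<le> f z} r u v"
      using p by (auto simp: poset_paths_def min_le_iff_disj)
    ultimately show ?thesis by blast
  qed
  from assms consider "(C, D) \<in> tree_order A r f" | "(D, C) \<in> tree_order A r f"
    by (auto simp: comparable_def)
  then show thesis
  proof cases
    case 1
    from *[OF 1] that show thesis by blast
  next
    case 2
    from *[OF 2] obtain u v p where uv: "v \<in> A" "u \<in> A" "C = tree_proj A r f v" "D = tree_proj A r f u"
      and p: "p \<in> poset_paths {z \<in> A. min (f u) (f v) \<le> f z} r u v"
      by blast
    have "rev p \<in> poset_paths {z \<in> A. min (f v) (f u) \<le> f z} r v u"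
      using poset_paths_rev[OF p] by (subst min.commute)
    then show thesis
      using that[OF uv] by blast
  qed
qed

text \<open>
  Consecutive classes of a tree path have representatives joined in \<open>R\<close> above the lower of the two
  heights, and any two representatives of one class are joined above their common height.
  Splicing these pieces never goes below the lowest height of the tree path.
\<close>

lemma tree_path_lift:
  assumes "P \<in> poset_paths (tree_carrier A r f) (tree_order A r f)
                (tree_proj A r f x) (tree_proj A r f y)"
    and "x \<in> A" "y \<in> A" and "\<And>C. C \<in> set P \<Longrightarrow> c \<le> tree_map f C"
  shows "poset_paths {z \<in> A. c \<le> f z} r x y \<noteq> {}"
  using assms
proof (induction P arbitrary: x rule: induct_list012)
  case 1
  then show ?case by (simp add: poset_paths_def)
next
  case (2 C)
  have C: "C = tree_proj A r f x" "C = tree_proj A r f y"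
    using poset_pathsD(3,4)[OF "2.prems"(1)] by simp_all
  have c: "c \<le> f x"
    using "2.prems"(4)[of C] C(1) tree_map_proj[OF "2.prems"(2), of f r] by simp
  have "(x, y) \<in> tree_equiv A r f"
    by (rule tree_proj_eqD[OF "2.prems"(3)]) (simp only: C[symmetric])
  from tree_equivD(4)[OF this] c show ?case
    by (rule joined_above_mono)
next
  case (3 C D P)
  have C: "C = tree_proj A r f x" and CD: "comparable (tree_order A r f) C D"
    using "3.prems"(1) by (auto simp: poset_paths_def)
  obtain u v where uv: "u \<in> A" "v \<in> A" "C = tree_proj A r f u" "D = tree_proj A r f v"
    and q: "poset_paths {z \<in> A. min (f u) (f v) \<le> f z} r u v \<noteq> {}"
    using tree_comparableE[OF CD] .
  have ge: "c \<le> f u" "c \<le> f v"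
    using "3.prems"(4)[of C] "3.prems"(4)[of D] uv(3,4)
      tree_map_proj[OF uv(1), of f r] tree_map_proj[OF uv(2), of f r] by simp_all
  have "(x, u) \<in> tree_equiv A r f"
    by (rule tree_proj_eqD[OF uv(1)]) (simp only: C[symmetric] uv(3)[symmetric])
  from tree_equivD(3,4)[OF this] have "poset_paths {z \<in> A. f u \<le> f z} r x u \<noteq> {}"
    by simp
  then have "poset_paths {z \<in> A. c \<le> f z} r x u \<noteq> {}"
    using ge(1) by (rule joined_above_mono)
  moreover have "poset_paths {z \<in> A. c \<le> f z} r u v \<noteq> {}"
    using ge by (intro joined_above_mono[OF q]) simp
  moreover have "poset_paths {z \<in> A. c \<le> f z} r v y \<noteq> {}"
  proof (rule "3.IH"(2))
    show "D # P \<in> poset_paths (tree_carrier A r f) (tree_order A r f)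
        (tree_proj A r f v) (tree_proj A r f y)"
      using "3.prems"(1) uv(4) by (auto simp: poset_paths_def)
  qed (use "3.prems" uv in auto)
  ultimately show ?case
    by (rule joined_trans[OF _ joined_trans])
qed

text \<open>
  The lowest height \<open>c\<close> of a tree path bounds the path's length from below by
  \<open>f x + f y - 2 c\<close>, and through lifting to \<open>R\<close> it bounds the Gromov product of \<open>x\<close> and \<open>y\<close>
  from below by \<open>c\<close> up to the hyperbolicity term.
\<close>

lemma reeb_dist_le_tree_dist:
  assumes R: "reeb_poset A r f" and x: "x \<in> A" and y: "y \<in> A"
  shows "reeb_dist A r f x y
    \<le> tree_dist A r f (tree_proj A r f x) (tree_proj A r f y)
      + 2 * log 2 (2 * real (max_fence_length A r)) * poset_hyp A r f"
    (is "_ \<le> _ + ?B")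
proof -
  let ?T = "poset_paths (tree_carrier A r f) (tree_order A r f)
              (tree_proj A r f x) (tree_proj A r f y)"
  have "reeb_dist A r f x y - ?B \<le> tree_dist A r f (tree_proj A r f x) (tree_proj A r f y)"
    unfolding tree_dist_def
  proof (rule reeb_dist_greatest)
    obtain p where "p \<in> poset_paths A r x y"
      using R x y by (fastforce simp: reeb_poset_def)
    from tree_proj_path[OF R this] show "?T \<noteq> {}" by auto
  next
    fix P assume P: "P \<in> ?T"
    note PD = poset_pathsD[OF P]
    define c where "c = Min (tree_map f ` set P)"
    have "c \<in> tree_map f ` set P"
      unfolding c_def using PD(1) by (intro Min_in) auto
    then obtain C where C: "C \<in> set P" "tree_map f C = c"
      by auto
    have c_le: "c \<le> tree_map f D" if "D \<in> set P" for D
      unfolding c_def using that by simp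
    have "f x + f y - 2 * c \<le> path_length (tree_map f) P"
      using path_length_ge_via[OF PD(1) C(1), of "tree_map f"] PD(3,4) C(2)
        tree_map_proj[OF x, of f r] tree_map_proj[OF y, of f r]
      by simp
    moreover have "poset_paths {z \<in> A. c \<le> f z} r x y \<noteq> {}"
      using tree_path_lift[OF P x y c_le] .
    from poset_gromov_ge_if_joined_above[OF R this]
    have "reeb_dist A r f x y \<le> f x + f y - 2 * c + ?B"
      by (simp add: poset_gromov_def)
    ultimately show "reeb_dist A r f x y - ?B \<le> path_length (tree_map f) P"
      by linarith
  qed
  then show ?thesis by linarith
qed

theorem theorem5p1:
  fixes A :: "'a set" and r :: "('a \<times> 'a) set" and f :: "'a \<Rightarrow> real" and x x' :: 'a
  assumes "reeb_poset A r f" and "x \<in> A" and "x' \<in> A"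
  shows "\<bar>reeb_dist A r f x x' - tree_dist A r f (tree_proj A r f x) (tree_proj A r f x')\<bar>
           \<le> 2 * log 2 (2 * real (max_fence_length A r)) * poset_hyp A r f"
  using tree_dist_le_reeb_dist[OF assms] reeb_dist_le_tree_dist[OF assms] by linarith

end
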